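(* Let $n$ be a positive integer and let $\zeta$ be a real transcendental number. Then $$\widehat{\lambda}_{n}(\zeta)\leq \frac{1}{\widehat{w}_{\lceil n/2\rceil}(\zeta)}.$$
   Context: For an integer $k\geq 1$ and a real transcendental number $\zeta$: $\widehat{\lambda}_{k}(\zeta)$ is the supremum of $\eta\in\mathbb{R}$ such that for all sufficiently large $X$ the system $|x|\leq X$, $\max_{1\leq i\leq k}|\zeta^{i}x-y_{i}|\leq X^{-\eta}$ has a non-zero solution $(x,y_{1},\ldots,y_{k})\in\mathbb{Z}^{k+1}$. For a polynomial $P$ with integer coefficients, the height $H(P)$ is the maximum of the absolute values of its coefficients. $\widehat{w}_{k}(\zeta)$ is the supremum of $\eta\in\mathbb{R}$ such that for all sufficiently large $X$ the system $H(P)\leq X$, $0<|P(\zeta)|\leq X^{-\eta}$ has a solution $P\in\mathbb{Z}[T]$ of degree at most $k$. *)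

theory Defs
  imports
    Complex_Main
    "HOL-Library.Extended_Real"
    "HOL-Computational_Algebra.Polynomial"
begin

(* The suprema are taken in the extended reals, so that they are meaningful without
   a prior proof that the sets of exponents are nonempty and bounded above.
   The parameter X ranges over the reals. *)

definition lambda_hat :: "nat \<Rightarrow> real \<Rightarrow> ereal" where
  "lambda_hat k \<zeta> = (SUP \<eta>\<in>{\<eta>::real. \<forall>\<^sub>F X::real in at_top.
     \<exists>(x::int) (y::nat \<Rightarrow> int). (x \<noteq> 0 \<or> (\<exists>i\<in>{1..k}. y i \<noteq> 0)) \<and>
       \<bar>real_of_int x\<bar> \<le> X \<and>
       (MAX i\<in>{1..k}. \<bar>\<zeta> ^ i * real_of_int x - real_of_int (y i)\<bar>) \<le> X powr (- \<eta>)}. ereal \<eta>)"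

definition poly_height :: "int poly \<Rightarrow> int" where
  "poly_height P = (MAX i\<in>{..degree P}. \<bar>coeff P i\<bar>)"

definition w_hat :: "nat \<Rightarrow> real \<Rightarrow> ereal" where
  "w_hat k \<zeta> = (SUP \<eta>\<in>{\<eta>::real. \<forall>\<^sub>F X::real in at_top.
     \<exists>P::int poly. degree P \<le> k \<and> real_of_int (poly_height P) \<le> X \<and>
       0 < \<bar>poly (map_poly real_of_int P) \<zeta>\<bar> \<and>
       \<bar>poly (map_poly real_of_int P) \<zeta>\<bar> \<le> X powr (- \<eta>)}. ereal \<eta>)"

end

theory Submission
  imports Defs "HOL-Computational_Algebra.Polynomial_Factorial"
begin

text \<open>
  Put \<open>m = \<lceil>n/2\<rceil>\<close>, so that \<open>2m - 1 \<le> n\<close>, and suppose that \<open>\<eta> > 0\<close> is admissible for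
  \<open>lambda_hat n\<close>, that \<open>\<omega> > 0\<close> is admissible for \<open>w_hat m\<close>, and that \<open>\<eta>\<omega> > 1\<close>.
  The contradiction comes from testing one integer vector \<open>y = (y\<^sub>0, \<dots>, y\<^sub>n)\<close>, with \<open>y\<^sub>0 = x\<close> and
  all \<open>\<zeta>\<^sup>i y\<^sub>0 - y\<^sub>i\<close> small, against two coprime polynomials that are small at \<open>\<zeta>\<close>.

  If \<open>R = \<Sum> r\<^sub>i T\<^sup>i\<close> has degree at most \<open>m\<close>, then for every \<open>j < m\<close> the integer \<open>\<Sum> r\<^sub>i y\<^sub>i\<^sub>+\<^sub>j\<close> equals
  \<open>y\<^sub>0 \<zeta>\<^sup>j R(\<zeta>)\<close> up to an error of order \<open>H(R) max \<bar>\<zeta>\<^sup>i y\<^sub>0 - y\<^sub>i\<bar>\<close>. Once both terms are small the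
  integer is zero (\<open>integer_relation_vanishes\<close>): the linear functional \<open>T\<^sup>k \<mapsto> y\<^sub>k\<close> on polynomials of
  degree below \<open>2m\<close> kills \<open>R, TR, \<dots>, T\<^sup>m\<^sup>-\<^sup>1R\<close>. If this holds for two coprime polynomials \<open>P, Q\<close>,
  a Bezout identity \<open>UP + VQ = r \<noteq> 0\<close> with \<open>deg U, deg V < m\<close> shows that the functional kills the
  constant \<open>r\<close>, so \<open>y\<^sub>0 = 0\<close> (\<open>common_recurrences_imp_first_0\<close>). Then all \<open>\<bar>y\<^sub>i\<bar> < 1\<close>, hence \<open>y = 0\<close>,
  which is excluded.

  The coprime pair is obtained as follows. For \<open>0 < v < \<omega>\<close> there are irreducible \<open>Q\<close> of
  arbitrarily large height \<open>H\<close> with \<open>\<bar>Q(\<zeta>)\<bar> < H\<^sup>-\<^sup>v\<close> (\<open>irreducible_approximations\<close>): heights are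
  multiplicative up to a constant (\<open>height_mult_le\<close>), so if all irreducible polynomials of large
  height satisfied the opposite inequality, so would all polynomials of degree at most \<open>m\<close>, up to
  a constant factor. As the exponent \<open>\<omega>\<close> is uniform, there is also a polynomial \<open>P\<close> of height at
  most \<open>DH\<close> with \<open>0 < \<bar>P(\<zeta>)\<bar> \<le> (DH)\<^sup>-\<^sup>\<omega>\<close>; for a small enough constant \<open>D\<close> its height is too small
  for a multiple of \<open>Q\<close>. Choosing \<open>1/\<eta> < v < \<omega>\<close> and \<open>X\<close> of order \<open>H\<^sup>1\<^sup>/\<^sup>\<eta>\<close> makes both error
  terms small for \<open>P\<close> and for \<open>Q\<close>.
\<close>

section \<open>Values and heights of integer polynomials\<close>

abbreviation real_eval :: "int poly \<Rightarrow> real \<Rightarrow> real" where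
  "real_eval P x \<equiv> poly (map_poly real_of_int P) x"

lemma real_eval_smult: "real_eval (smult c P) x = real_of_int c * real_eval P x"
  by (simp add: map_poly_smult[of real_of_int])

lemma real_eval_mult: "real_eval (P * Q) x = real_eval P x * real_eval Q x"
proof -
  have add: "real_eval (P + Q) x = real_eval P x + real_eval Q x" for P Q
  proof -
    have "map_poly real_of_int (P + Q) = map_poly real_of_int P + map_poly real_of_int Q"
      by (intro poly_eqI) (simp add: coeff_map_poly)
    then show ?thesis by simp
  qed
  show ?thesis
  proof (induction P)
    case (pCons a P)
    have "real_eval (pCons a P * Q) x = real_eval (smult a Q) x + real_eval (pCons 0 (P * Q)) x"
      by (simp only: mult_pCons_left add)
    also have "\<dots> = real_of_int a * real_eval Q x + x * (real_eval P x * real_eval Q x)"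
      using pCons.IH by (simp add: real_eval_smult map_poly_pCons)
    finally show ?case
      by (simp add: map_poly_pCons algebra_simps)
  qed simp
qed

lemma real_eval_altdef:
  assumes "degree P \<le> m"
  shows "real_eval P x = (\<Sum>i\<le>m. real_of_int (coeff P i) * x ^ i)"
proof -
  have "real_eval P x = (\<Sum>i\<le>degree P. real_of_int (coeff P i) * x ^ i)"
    by (simp add: poly_altdef degree_map_poly coeff_map_poly)
  also have "\<dots> = (\<Sum>i\<le>m. real_of_int (coeff P i) * x ^ i)"
    using assms by (intro sum.mono_neutral_left) (auto simp: coeff_eq_0)
  finally show ?thesis .
qed

lemma real_eval_nonzero:
  assumes "\<not> algebraic x" "P \<noteq> 0"
  shows "real_eval P x \<noteq> 0"
proof
  assume "real_eval P x = 0"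
  moreover have "map_poly real_of_int P \<noteq> 0"
    using assms(2) by (simp add: map_poly_eq_0_iff)
  moreover have "\<forall>i. coeff (map_poly real_of_int P) i \<in> \<int>"
    by (simp add: coeff_map_poly)
  ultimately show False
    using assms(1) unfolding algebraic_def by blast
qed

lemma abs_coeff_le_height: "\<bar>coeff P i\<bar> \<le> poly_height P"
proof (cases "i \<le> degree P")
  case True
  then show ?thesis
    unfolding poly_height_def by (intro Max_ge) auto
next
  case False
  have "\<bar>coeff P 0\<bar> \<le> poly_height P"
    unfolding poly_height_def by (intro Max_ge) auto
  with False show ?thesis
    by (simp add: coeff_eq_0)
qed

lemma height_leI:
  assumes "\<And>i. \<bar>coeff P i\<bar> \<le> B"
  shows "poly_height P \<le> B"
  unfolding poly_height_def using assms by (subst Max_le_iff) auto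

lemma height_pos:
  assumes "P \<noteq> 0"
  shows "poly_height P \<ge> 1"
proof -
  have "1 \<le> \<bar>coeff P (degree P)\<bar>"
    using assms by (simp add: int_one_le_iff_zero_less)
  then show ?thesis
    using abs_coeff_le_height[of P "degree P"] by linarith
qed

lemma height_le_height_smult:
  assumes "c \<noteq> 0"
  shows "poly_height P \<le> poly_height (smult c P)"
proof (rule height_leI)
  fix i
  have "1 * \<bar>coeff P i\<bar> \<le> \<bar>c\<bar> * \<bar>coeff P i\<bar>"
    using assms by (intro mult_right_mono) auto
  also have "\<dots> \<le> poly_height (smult c P)"
    using abs_coeff_le_height[of "smult c P" i] by (simp add: abs_mult)
  finally show "\<bar>coeff P i\<bar> \<le> poly_height (smult c P)" by simp
qed

lemma abs_poly_le_height:
  fixes P :: "int poly"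
  assumes "degree P \<le> d" "0 \<le> t" "t \<le> int d"
  shows "\<bar>poly P t\<bar> \<le> (int d + 1) ^ (d + 1) * poly_height P"
proof -
  have h: "0 \<le> poly_height P"
    using abs_coeff_le_height[of P 0] by linarith
  have "\<bar>poly P t\<bar> \<le> (\<Sum>i\<le>degree P. \<bar>coeff P i * t ^ i\<bar>)"
    unfolding poly_altdef by (rule sum_abs)
  also have "\<dots> \<le> (\<Sum>i\<le>degree P. poly_height P * (int d + 1) ^ d)"
  proof (intro sum_mono)
    fix i assume i: "i \<in> {..degree P}"
    have "t ^ i \<le> (int d + 1) ^ i"
      using assms by (intro power_mono) auto
    also have "\<dots> \<le> (int d + 1) ^ d"
      using assms i by (intro power_increasing) auto
    finally have "t ^ i \<le> (int d + 1) ^ d" .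
    then show "\<bar>coeff P i * t ^ i\<bar> \<le> poly_height P * (int d + 1) ^ d"
      using assms h abs_coeff_le_height[of P i]
      by (auto simp: abs_mult power_abs intro!: mult_mono)
  qed
  also have "\<dots> = (int (degree P) + 1) * (poly_height P * (int d + 1) ^ d)"
    by simp
  also have "\<dots> \<le> (int d + 1) * (poly_height P * (int d + 1) ^ d)"
    using assms h by (intro mult_right_mono) auto
  finally show ?thesis
    by (simp add: algebra_simps)
qed

section \<open>The height of a product\<close>

text \<open>
  An integer polynomial is controlled by its values at sufficiently many integers. The induction
  divides by \<open>T - s\<close>: at an integer \<open>t \<noteq> s\<close> the quotient has absolute value at most
  \<open>\<bar>A(t) - A(s)\<bar>\<close>, because \<open>\<bar>t - s\<bar> \<ge> 1\<close>.
\<close>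
lemma coeff_bound_from_values:
  fixes A :: "int poly" and S :: "int set"
  assumes "degree A \<le> d" "finite S" "card S = Suc d" "S \<subseteq> {0..N}" "\<And>t. t \<in> S \<Longrightarrow> \<bar>poly A t\<bar> \<le> M"
  shows "\<bar>coeff A i\<bar> \<le> (2 * N + 3) ^ d * M"
  using assms
proof (induction d arbitrary: A S M i)
  case 0
  then obtain t where t: "t \<in> S" by fastforce
  obtain a where "A = [:a:]"
    using 0 by (auto elim: degree_eq_zeroE)
  with 0(5)[OF t] show ?case
    by (cases i) auto
next
  case (Suc d)
  obtain s where s: "s \<in> S" using Suc.prems by fastforce
  have sN: "0 \<le> s" "s \<le> N" using s Suc.prems by auto
  define B where "B = synthetic_div A s"
  have A: "A = [:-s, 1:] * B + [:poly A s:]"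
    unfolding B_def by (simp only: synthetic_div_correct')
  have M: "0 \<le> M" using Suc.prems(5)[OF s] by linarith
  define K where "K = (2 * N + 3) ^ d"
  have K: "K \<ge> 1" unfolding K_def using sN by simp
  have B_bound: "\<bar>coeff B i\<bar> \<le> K * (2 * M)" for i
    unfolding K_def
  proof (rule Suc.IH[where S = "S - {s}"])
    show "degree B \<le> d"
      using Suc.prems by (simp add: B_def degree_synthetic_div)
    show "card (S - {s}) = Suc d"
      using Suc.prems s by simp
    fix t assume t: "t \<in> S - {s}"
    have "poly A t = (t - s) * poly B t + poly A s"
      using arg_cong[OF A, of "\<lambda>p. poly p t"] by (simp add: algebra_simps)
    then have "\<bar>(t - s) * poly B t\<bar> \<le> 2 * M"
      using Suc.prems(5)[of t] Suc.prems(5)[OF s] t by auto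
    moreover have "1 * \<bar>poly B t\<bar> \<le> \<bar>t - s\<bar> * \<bar>poly B t\<bar>"
      using t by (intro mult_right_mono) auto
    ultimately show "\<bar>poly B t\<bar> \<le> 2 * M"
      by (simp add: abs_mult)
  qed (use Suc.prems in auto)
  have "\<bar>coeff A i\<bar> \<le> N * (K * (2 * M)) + K * (2 * M) + M"
  proof -
    have 1: "\<bar>s * coeff B i\<bar> \<le> N * (K * (2 * M))"
      using sN B_bound[of i] by (auto simp: abs_mult intro!: mult_mono)
    have KM: "0 \<le> K * (2 * M)" using K M by simp
    show ?thesis
    proof (cases i)
      case 0
      have "coeff A i = - (s * coeff B i) + poly A s"
        using arg_cong[OF A, of "\<lambda>p. coeff p i"] 0 by simp
      then show ?thesis
        using 1 KM Suc.prems(5)[OF s] by linarith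
    next
      case (Suc k)
      have "coeff A i = - (s * coeff B i) + coeff B k"
        using arg_cong[OF A, of "\<lambda>p. coeff p i"] Suc by simp
      then show ?thesis
        using 1 M B_bound[of k] by linarith
    qed
  qed
  also have "\<dots> \<le> (2 * N + 3) * K * M"
  proof -
    have "1 * M \<le> K * M" using K M by (intro mult_right_mono) auto
    then show ?thesis by (simp add: algebra_simps)
  qed
  finally show ?case
    by (simp add: K_def)
qed

lemma card_small_values_le_degree:
  fixes A :: "int poly"
  assumes "A \<noteq> 0" "degree A \<le> d" "N \<ge> 0"
  shows "card {t \<in> {0..N}. (2 * N + 3) ^ d * \<bar>poly A t\<bar> < poly_height A} \<le> degree A"
    (is "card ?E \<le> _")
proof (rule ccontr)
  assume "\<not> ?thesis"
  then have "Suc (degree A) \<le> card ?E" by simp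
  then obtain S where S: "S \<subseteq> ?E" "card S = Suc (degree A)" "finite S"
    by (rule obtain_subset_with_card_n)
  define M where "M = Max ((\<lambda>t. \<bar>poly A t\<bar>) ` S)"
  have "M \<in> (\<lambda>t. \<bar>poly A t\<bar>) ` S"
    unfolding M_def using S by (intro Max_in) auto
  then obtain t where t: "t \<in> S" "\<bar>poly A t\<bar> = M" by auto
  have "poly_height A \<le> (2 * N + 3) ^ degree A * M"
  proof (intro height_leI coeff_bound_from_values)
    show "\<bar>poly A t\<bar> \<le> M" if "t \<in> S" for t
      unfolding M_def using that S by (intro Max_ge) auto
  qed (use S in auto)
  also have "\<dots> \<le> (2 * N + 3) ^ d * M"
    using t assms by (intro mult_right_mono power_increasing) auto
  finally show False
    using S t by fastforce
qed

text \<open>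
  A form of Gelfond's inequality. Each factor is small compared with its height at no more points of
  \<open>{0..d}\<close> than its degree. As the degrees add up to at most \<open>d\<close> and there are \<open>d + 1\<close> points, some
  point is good for both factors, and there the product is large.
\<close>
lemma height_mult_le:
  obtains C :: int where "C \<ge> 1"
    "\<And>A B. A * B \<noteq> 0 \<Longrightarrow> degree (A * B) \<le> d \<Longrightarrow>
       poly_height A * poly_height B \<le> C * poly_height (A * B)"
proof
  define K :: int where "K = (2 * int d + 3) ^ d"
  have K: "K \<ge> 1" by (simp add: K_def)
  let ?C = "K * K * (int d + 1) ^ (d + 1)"
  show "?C \<ge> 1"
    using K by (simp add: int_one_le_iff_zero_less)
  fix A B :: "int poly" assume AB: "A * B \<noteq> 0" and deg: "degree (A * B) \<le> d"
  have degs: "degree A + degree B \<le> d"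
    using AB deg by (simp add: degree_mult_eq)
  define E where "E R = {t \<in> {0..int d}. K * \<bar>poly R t\<bar> < poly_height R}" for R :: "int poly"
  have "card (E A) \<le> degree A" "card (E B) \<le> degree B"
    unfolding E_def K_def using AB degs by (intro card_small_values_le_degree; auto)+
  then have "card (E A \<union> E B) \<le> d"
    using card_Un_le[of "E A" "E B"] degs by linarith
  moreover have "finite (E A \<union> E B)"
    by (rule finite_subset[of _ "{0..int d}"]) (auto simp: E_def)
  moreover have "card {0..int d} = Suc d" by simp
  ultimately have "\<not> {0..int d} \<subseteq> E A \<union> E B"
    using card_mono[of "E A \<union> E B" "{0..int d}"] by linarith
  then obtain t where "t \<in> {0..int d}" "t \<notin> E A \<union> E B" by blast
  then have t: "0 \<le> t" "t \<le> int d" "t \<notin> E A" "t \<notin> E B" by auto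
  have "poly_height A \<le> K * \<bar>poly A t\<bar>" "poly_height B \<le> K * \<bar>poly B t\<bar>"
    using t by (auto simp: E_def)
  then have "poly_height A * poly_height B \<le> (K * \<bar>poly A t\<bar>) * (K * \<bar>poly B t\<bar>)"
    using AB K height_pos[of B] by (intro mult_mono) auto
  also have "\<dots> = K * K * \<bar>poly (A * B) t\<bar>"
    by (simp add: abs_mult)
  also have "\<dots> \<le> K * K * ((int d + 1) ^ (d + 1) * poly_height (A * B))"
    using t deg K by (intro mult_left_mono abs_poly_le_height) auto
  finally show "poly_height A * poly_height B \<le> ?C * poly_height (A * B)"
    by (simp add: algebra_simps)
qed

section \<open>Irreducible polynomials with small values\<close>

lemma finite_bounded_height: "finite {P. degree P \<le> m \<and> poly_height P \<le> B}"
proof (rule finite_subset)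
  show "finite (Poly ` {xs. set xs \<subseteq> {-B..B} \<and> length xs \<le> Suc m})"
    by (intro finite_imageI finite_lists_length_le) auto
  show "{P. degree P \<le> m \<and> poly_height P \<le> B} \<subseteq> Poly ` {xs. set xs \<subseteq> {-B..B} \<and> length xs \<le> Suc m}"
  proof
    fix P assume P: "P \<in> {P. degree P \<le> m \<and> poly_height P \<le> B}"
    have "P = Poly (coeffs P)" by simp
    moreover have "set (coeffs P) \<subseteq> {-B..B}"
    proof
      fix c assume "c \<in> set (coeffs P)"
      then obtain i where "c = coeff P i"
        by (auto simp: coeffs_def split: if_splits)
      then show "c \<in> {-B..B}"
        using abs_coeff_le_height[of P i] P by auto
    qed
    moreover have "length (coeffs P) \<le> Suc m"
      using P by (cases "P = 0") (auto simp: length_coeffs_degree)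
    ultimately show "P \<in> Poly ` {xs. set xs \<subseteq> {-B..B} \<and> length xs \<le> Suc m}"
      by blast
  qed
qed

lemma eval_lower_bound_of_bounded_height:
  assumes "\<not> algebraic \<zeta>"
  obtains c where "c > 0"
    "\<And>P. P \<noteq> 0 \<Longrightarrow> degree P \<le> m \<Longrightarrow> poly_height P \<le> B \<Longrightarrow> c \<le> \<bar>real_eval P \<zeta>\<bar>"
proof
  let ?V = "insert 1 ((\<lambda>P. \<bar>real_eval P \<zeta>\<bar>) ` ({P. degree P \<le> m \<and> poly_height P \<le> B} - {0}))"
  have fin: "finite ?V" using finite_bounded_height by simp
  show "Min ?V > 0"
    using fin real_eval_nonzero[OF assms] by (subst Min_gr_iff) auto
  show "Min ?V \<le> \<bar>real_eval P \<zeta>\<bar>" if "P \<noteq> 0" "degree P \<le> m" "poly_height P \<le> B" for P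
    using fin that by (intro Min_le) auto
qed

text \<open>
  A lower bound for irreducible polynomials extends to all polynomials of bounded degree, because
  values are multiplicative and heights almost are. The constant worsens at each
  factorization, but the degree bounds the number of nonconstant factors, and the content only helps.
  Irreducible polynomials of bounded degree and height are finite in number, so their values are bounded away
  from zero by transcendence.
\<close>
lemma eval_lower_bound_from_irreducibles:
  fixes w \<zeta> :: real
  assumes "\<not> algebraic \<zeta>" "w > 0"
    and irr: "\<And>Q. irreducible Q \<Longrightarrow> 0 < degree Q \<Longrightarrow> degree Q \<le> m \<Longrightarrow> poly_height Q > B \<Longrightarrow>
      real_of_int (poly_height Q) powr (-w) \<le> \<bar>real_eval Q \<zeta>\<bar>"
  obtains c where "c > 0"
    "\<And>P. P \<noteq> 0 \<Longrightarrow> degree P \<le> m \<Longrightarrow> c * real_of_int (poly_height P) powr (-w) \<le> \<bar>real_eval P \<zeta>\<bar>"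
proof -
  obtain b where b: "b > 0"
    "\<And>P. P \<noteq> 0 \<Longrightarrow> degree P \<le> m \<Longrightarrow> poly_height P \<le> B \<Longrightarrow> b \<le> \<bar>real_eval P \<zeta>\<bar>"
    using eval_lower_bound_of_bounded_height[OF assms(1)] by blast
  obtain C :: int where C: "C \<ge> 1" "\<And>A B. A * B \<noteq> 0 \<Longrightarrow> degree (A * B) \<le> m \<Longrightarrow>
       poly_height A * poly_height B \<le> C * poly_height (A * B)"
    by (rule height_mult_le[of m]) blast
  define h where "h P = real_of_int (poly_height P) powr (-w)" for P
  have h_pos: "0 < h P" and h_le_1: "h P \<le> 1" if "P \<noteq> 0" for P
    using height_pos[OF that] assms(2) by (auto simp: h_def powr_minus divide_simps intro!: ge_one_powr_ge_zero)
  have h_antimono: "h P \<le> h R" if "R \<noteq> 0" "poly_height R \<le> poly_height P" for P R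
    unfolding h_def using height_pos[OF that(1)] that(2) assms(2) by (intro powr_mono2') auto
  define b' where "b' = min b 1"
  have b': "b' > 0" using b(1) by (simp add: b'_def)
  have irr': "b' * h Q \<le> \<bar>real_eval Q \<zeta>\<bar>" if Q: "irreducible Q" "0 < degree Q" "degree Q \<le> m" for Q
  proof -
    have Q0: "Q \<noteq> 0" using Q by auto
    show ?thesis
    proof (cases "poly_height Q > B")
      case True
      have "b' * h Q \<le> 1 * h Q"
        using h_pos[OF Q0] by (intro mult_right_mono) (auto simp: b'_def)
      with irr[OF Q True] show ?thesis by (simp add: h_def)
    next
      case False
      have "b' * h Q \<le> b * 1"
        using h_pos[OF Q0] h_le_1[OF Q0] b(1) by (intro mult_mono) (auto simp: b'_def)
      with b(2)[OF Q0 Q(3)] False show ?thesis by simp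
    qed
  qed
  have "\<exists>c>0. \<forall>P. P \<noteq> 0 \<and> degree P \<le> k \<and> degree P \<le> m \<longrightarrow> c * h P \<le> \<bar>real_eval P \<zeta>\<bar>" for k
  proof (induction k)
    case 0
    have "1 * h P \<le> \<bar>real_eval P \<zeta>\<bar>" if P: "P \<noteq> 0" "degree P = 0" for P
    proof -
      obtain a where a: "P = [:a:]" using P(2) by (rule degree_eq_zeroE)
      then have "1 \<le> \<bar>a\<bar>" using P(1) by (simp add: int_one_le_iff_zero_less)
      then have "1 \<le> \<bar>real_of_int a\<bar>" by linarith
      then show ?thesis using h_le_1[OF P(1)] a by (simp add: map_poly_pCons)
    qed
    then show ?case by (intro exI[of _ 1]) auto
  next
    case (Suc k)
    then obtain c where c: "c > 0"
      "\<And>P. P \<noteq> 0 \<Longrightarrow> degree P \<le> k \<Longrightarrow> degree P \<le> m \<Longrightarrow> c * h P \<le> \<bar>real_eval P \<zeta>\<bar>"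
      by auto
    define c' where "c' = min (min b' c) (c * c * real_of_int C powr (-w))"
    have c': "c' > 0" using b' c(1) C(1) by (simp add: c'_def)
    \<comment> \<open>Primitivity rules out constant nonunit factors, so a factorization lowers both degrees.\<close>
    have primitive: "c' * h P \<le> \<bar>real_eval P \<zeta>\<bar>"
      if P: "content P = 1" "0 < degree P" "degree P \<le> Suc k" "degree P \<le> m" for P
    proof (cases "irreducible P")
      case True
      have "P \<noteq> 0" using P(2) by auto
      then have "c' * h P \<le> b' * h P"
        using h_pos[of P] by (intro mult_right_mono) (auto simp: c'_def)
      with irr'[OF True P(2,4)] show ?thesis by linarith
    next
      case False
      have P0: "P \<noteq> 0" using P(2) by auto
      moreover have "\<not> P dvd 1"
        using P(2) by (auto simp: is_unit_poly_iff)
      ultimately obtain R S where RS: "P = R * S" "\<not> R dvd 1" "\<not> S dvd 1"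
        using False by (meson irreducibleI)
      have nonconst: "0 < degree T" if "T dvd P" "\<not> T dvd 1" for T
      proof (rule ccontr)
        assume "\<not> ?thesis"
        then obtain a where a: "T = [:a:]" using degree_eq_zeroE by blast
        then have "a dvd 1"
          using that(1) P(1) by (simp add: const_poly_dvd_iff_dvd_content)
        with that(2) a show False by (simp add: is_unit_const_poly_iff)
      qed
      have R: "R \<noteq> 0" "0 < degree R" and S: "S \<noteq> 0" "0 < degree S"
        using RS P0 nonconst[of R] nonconst[of S] by auto
      have deg: "degree P = degree R + degree S"
        using R S RS(1) by (simp add: degree_mult_eq)
      have "poly_height R * poly_height S \<le> C * poly_height P"
        using C(2)[of R S] P0 P(4) RS(1) by simp
      then have "real_of_int (poly_height R * poly_height S) \<le> real_of_int (C * poly_height P)"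
        by (simp only: of_int_le_iff)
      then have "(real_of_int C * real_of_int (poly_height P)) powr (-w)
          \<le> (real_of_int (poly_height R) * real_of_int (poly_height S)) powr (-w)"
        using height_pos[OF R(1)] height_pos[OF S(1)] assms(2) by (intro powr_mono2') auto
      then have hRS: "real_of_int C powr (-w) * h P \<le> h R * h S"
        using height_pos[OF R(1)] height_pos[OF S(1)] height_pos[OF P0] C(1)
        by (simp add: h_def powr_mult)
      have "c' * h P \<le> (c * c * real_of_int C powr (-w)) * h P"
        using h_pos[OF P0] by (intro mult_right_mono) (auto simp: c'_def)
      also have "\<dots> \<le> (c * h R) * (c * h S)"
        using mult_left_mono[OF hRS, of "c * c"] c(1) by (simp add: mult_ac)
      also have "\<dots> \<le> \<bar>real_eval R \<zeta>\<bar> * \<bar>real_eval S \<zeta>\<bar>"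
        using c(1) h_pos[OF R(1)] h_pos[OF S(1)] P R S deg by (intro mult_mono c(2)) auto
      also have "\<dots> = \<bar>real_eval P \<zeta>\<bar>"
        by (simp add: RS(1) real_eval_mult abs_mult)
      finally show ?thesis .
    qed
    have "c' * h P \<le> \<bar>real_eval P \<zeta>\<bar>" if P: "P \<noteq> 0" "degree P \<le> Suc k" "degree P \<le> m" for P
    proof (cases "degree P = 0")
      case True
      have "c' * h P \<le> c * h P"
        using h_pos[OF P(1)] by (intro mult_right_mono) (auto simp: c'_def)
      with c(2)[OF P(1)] True show ?thesis by simp
    next
      case False
      let ?P = "primitive_part P" and ?a = "content P"
      have P_eq: "P = smult ?a ?P" by simp
      have a: "?a \<noteq> 0" using P(1) by simp
      have "c' * h P \<le> c' * h ?P"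
        using c' height_le_height_smult[OF a, of ?P] P(1) by (intro mult_left_mono h_antimono) auto
      also have "\<dots> \<le> 1 * \<bar>real_eval ?P \<zeta>\<bar>"
        using P False primitive[of ?P] by simp
      also have "\<dots> \<le> \<bar>real_of_int ?a\<bar> * \<bar>real_eval ?P \<zeta>\<bar>"
        using a by (intro mult_right_mono) linarith+
      also have "\<dots> = \<bar>real_eval P \<zeta>\<bar>"
        by (subst (3) P_eq) (simp only: real_eval_smult abs_mult)
      finally show ?thesis .
    qed
    with c' show ?case by blast
  qed
  from this[of m] show ?thesis
    using that by (auto simp: h_def)
qed

definition poly_solvable :: "nat \<Rightarrow> real \<Rightarrow> real \<Rightarrow> real \<Rightarrow> bool" where
  "poly_solvable k \<zeta> w X \<longleftrightarrow> (\<exists>P::int poly. degree P \<le> k \<and> real_of_int (poly_height P) \<le> X \<and>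
     0 < \<bar>real_eval P \<zeta>\<bar> \<and> \<bar>real_eval P \<zeta>\<bar> \<le> X powr (- w))"

text \<open>
  Otherwise the preceding lemma gives \<open>\<bar>P(\<zeta>)\<bar> \<ge> c H(P)\<^sup>-\<^sup>v\<close> for all \<open>P\<close>, which the solutions
  \<open>P\<close> with exponent \<open>w > v\<close> violate once \<open>X\<^sup>v\<^sup>-\<^sup>w < c\<close>.
\<close>
lemma irreducible_approximations:
  fixes v w \<zeta> :: real
  assumes "\<not> algebraic \<zeta>" "0 < v" "v < w"
    and approx: "\<forall>\<^sub>F X::real in at_top. poly_solvable m \<zeta> w X"
  shows "\<exists>Q. irreducible Q \<and> 0 < degree Q \<and> degree Q \<le> m \<and> poly_height Q > B \<and>
    \<bar>real_eval Q \<zeta>\<bar> < real_of_int (poly_height Q) powr (-v)"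
proof (rule ccontr)
  assume none: "\<not> ?thesis"
  have "real_of_int (poly_height Q) powr (-v) \<le> \<bar>real_eval Q \<zeta>\<bar>"
    if "irreducible Q" "0 < degree Q" "degree Q \<le> m" "poly_height Q > B" for Q
    using none that not_le by blast
  then obtain c where c: "c > 0"
    "\<And>P. P \<noteq> 0 \<Longrightarrow> degree P \<le> m \<Longrightarrow> c * real_of_int (poly_height P) powr (-v) \<le> \<bar>real_eval P \<zeta>\<bar>"
    using eval_lower_bound_from_irreducibles[OF assms(1,2), of m B] by blast
  have "((\<lambda>X::real. X powr (v - w)) \<longlongrightarrow> 0) at_top"
    using assms(3) by (intro tendsto_neg_powr filterlim_ident) auto
  then have "\<forall>\<^sub>F X::real in at_top. X powr (v - w) < c"
    using c(1) by (rule order_tendstoD)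
  with approx have "\<forall>\<^sub>F X::real in at_top. False"
  proof (eventually_elim)
    case (elim X)
    then obtain P where P: "degree P \<le> m" "poly_height P \<le> X" "0 < \<bar>real_eval P \<zeta>\<bar>"
      "\<bar>real_eval P \<zeta>\<bar> \<le> X powr (- w)" unfolding poly_solvable_def by blast
    have P0: "P \<noteq> 0" using P(3) by auto
    have H: "1 \<le> real_of_int (poly_height P)"
      using height_pos[OF P0] by simp
    have "c * real_of_int (poly_height P) powr (-v) \<le> X powr (-w)"
      using c(2)[OF P0 P(1)] P(4) by linarith
    also have "\<dots> = X powr (v - w) * X powr (-v)"
      by (simp flip: powr_add)
    also have "\<dots> < c * X powr (-v)"
      using elim(2) H P(2) by (intro mult_strict_right_mono) auto
    also have "\<dots> \<le> c * real_of_int (poly_height P) powr (-v)"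
      using H P(2) c(1) assms(2) by (intro mult_left_mono powr_mono2') auto
    finally show False by simp
  qed
  then show False by simp
qed

section \<open>Coprime polynomials annihilating the same vector\<close>

text \<open>
  The integer polynomials do not form a principal ideal domain, but a nonzero element \<open>R\<close> of minimal
  degree in the ideal \<open>(P, Q)\<close> still divides constant multiples of both \<open>P\<close> and \<open>Q\<close>, by
  pseudo-division. Primality of \<open>Q\<close> then forces \<open>R\<close> to be constant.
\<close>
lemma bezout_of_not_dvd_irreducible:
  fixes P Q :: "int poly"
  assumes "irreducible Q" "degree Q > 0" "\<not> Q dvd P"
  obtains U V r where "r \<noteq> 0" "U * P + V * Q = [:r:]" "degree U < degree Q"
proof -
  have prime: "prime_elem Q"
    using assms(1) by (rule irreducible_imp_prime_elem)
  have const: "\<not> Q dvd [:c:]" if "c \<noteq> 0" for c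
    using dvd_imp_degree_le[of Q "[:c:]"] assms(2) that by auto
  have smult_dvd: "Q dvd R" if "Q dvd smult c R" "c \<noteq> 0" for c R
  proof -
    have "Q dvd [:c:] * R" using that(1) by simp
    then show ?thesis
      using prime_elem_dvd_mult_iff[OF prime] const[OF that(2)] by blast
  qed
  have Q0: "Q \<noteq> 0" using assms(2) by auto
  define I where "I = {R. R \<noteq> 0 \<and> (\<exists>U V. R = U * P + V * Q)}"
  have "Q = 0 * P + 1 * Q" by simp
  then have "Q \<in> I" unfolding I_def using Q0 by blast
  then obtain R where R: "R \<in> I" and min: "\<And>R'. R' \<in> I \<Longrightarrow> degree R \<le> degree R'"
    using ex_has_least_nat[of "\<lambda>R. R \<in> I" Q degree] by blast
  from R obtain U V where R0: "R \<noteq> 0" and UV: "R = U * P + V * Q"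
    unfolding I_def by auto
  have dvd: "\<exists>c W. c \<noteq> 0 \<and> smult c S = R * W" if S: "S = U' * P + V' * Q" for S U' V'
  proof -
    obtain c W where cW: "c \<noteq> 0" "smult c S = R * W + pseudo_mod S R"
      using pseudo_mod(1)[OF R0, of S] by blast
    have "pseudo_mod S R = (smult c U' - W * U) * P + (smult c V' - W * V) * Q"
      using cW(2) by (simp add: S UV algebra_simps smult_add_right)
    then have "pseudo_mod S R = 0"
      using pseudo_mod(2)[OF R0, of S] min[of "pseudo_mod S R"] unfolding I_def by force
    with cW show ?thesis by auto
  qed
  obtain c W where cW: "c \<noteq> 0" "smult c Q = R * W"
    using dvd[of Q 0 1] by auto
  obtain c' W' where cW': "c' \<noteq> 0" "smult c' P = R * W'"
    using dvd[of P 1 0] by auto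
  have "Q dvd R * W" by (metis cW(2) dvd_smult dvd_refl)
  moreover have "\<not> Q dvd R"
    using smult_dvd[of c' P] cW' assms(3) by (metis dvd_mult2)
  ultimately have "Q dvd W"
    using prime prime_elem_dvd_mult_iff by blast
  moreover have "W \<noteq> 0" using cW Q0 by auto
  ultimately have "degree Q \<le> degree W" by (intro dvd_imp_degree_le)
  moreover have "degree Q = degree R + degree W"
    using arg_cong[OF cW(2), of degree] cW(1) R0 \<open>W \<noteq> 0\<close> by (simp add: degree_mult_eq)
  ultimately have "degree R = 0" by simp
  then obtain r where r: "R = [:r:]" by (rule degree_eq_zeroE)
  \<comment> \<open>A Bezout identity is found; reducing the first cofactor modulo \<open>Q\<close> bounds its degree.\<close>
  obtain d T where dT: "d \<noteq> 0" "smult d U = Q * T + pseudo_mod U Q"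
    using pseudo_mod(1)[OF Q0, of U] by blast
  show ?thesis
  proof (rule that)
    show "d * r \<noteq> 0" using dT(1) R0 r by auto
    have "[:d * r:] = smult d (U * P + V * Q)"
      by (simp add: r flip: UV)
    also have "\<dots> = smult d U * P + smult d V * Q"
      by (simp add: smult_add_right)
    also have "\<dots> = pseudo_mod U Q * P + (T * P + smult d V) * Q"
      by (simp only: dT(2) distrib_right distrib_left add_ac mult_ac)
    finally show "pseudo_mod U Q * P + (T * P + smult d V) * Q = [:d * r:]" by (rule sym)
    show "degree (pseudo_mod U Q) < degree Q"
      using pseudo_mod(2)[OF Q0, of U] assms(2) by auto
  qed
qed

text \<open>
  In terms of the linear functional \<open>T\<^sup>k \<mapsto> y\<^sub>k\<close>, the hypothesis says that it kills \<open>T\<^sup>j P\<close> for \<open>j < m\<close>,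
  so it kills every combination \<open>U P\<close> of these.
\<close>
lemma functional_mult_eq_0:
  fixes P U :: "int poly" and y :: "nat \<Rightarrow> int"
  assumes "degree P \<le> m" "degree U < m" "\<And>j. j < m \<Longrightarrow> (\<Sum>i\<le>m. coeff P i * y (i + j)) = 0"
  shows "(\<Sum>k<2 * m. coeff (U * P) k * y k) = 0"
proof -
  have shift: "(\<Sum>k<2 * m. coeff (monom c j * P) k * y k) = 0" if j: "j < m" for c j
  proof -
    have "(\<Sum>k<2 * m. coeff (monom c j * P) k * y k)
        = (\<Sum>k\<in>(\<lambda>i. i + j) ` {..m}. coeff (monom c j * P) k * y k)"
    proof (intro sum.mono_neutral_right ballI)
      fix k assume k: "k \<in> {..<2 * m} - (\<lambda>i. i + j) ` {..m}"
      have "k < j \<or> k - j > m"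
      proof (rule ccontr)
        assume "\<not> ?thesis"
        then have "k = (k - j) + j" "k - j \<in> {..m}" by auto
        with k show False by blast
      qed
      then show "coeff (monom c j * P) k * y k = 0"
        using assms(1) by (auto simp: coeff_monom_mult coeff_eq_0)
    qed (use j in auto)
    also have "\<dots> = (\<Sum>i\<le>m. c * (coeff P i * y (i + j)))"
      by (subst sum.reindex) (auto simp: coeff_monom_mult inj_on_def mult.assoc)
    also have "\<dots> = 0"
      using assms(3)[OF j] by (simp flip: sum_distrib_left)
    finally show ?thesis .
  qed
  have "U * P = (\<Sum>j\<le>degree U. monom (coeff U j) j * P)"
    by (subst poly_as_sum_of_monoms[symmetric, of U]) (simp add: sum_distrib_right)
  then have "(\<Sum>k<2 * m. coeff (U * P) k * y k)
      = (\<Sum>k<2 * m. \<Sum>j\<le>degree U. coeff (monom (coeff U j) j * P) k * y k)"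
    by (simp add: coeff_sum sum_distrib_right)
  also have "\<dots> = (\<Sum>j\<le>degree U. \<Sum>k<2 * m. coeff (monom (coeff U j) j * P) k * y k)"
    by (rule sum.swap)
  also have "\<dots> = 0"
    using assms(2) by (intro sum.neutral ballI shift) auto
  finally show ?thesis .
qed

lemma common_recurrences_imp_first_0:
  fixes P Q :: "int poly" and y :: "nat \<Rightarrow> int"
  assumes "irreducible Q" "0 < degree Q" "degree Q \<le> m" "degree P \<le> m" "\<not> Q dvd P"
    and "\<And>j. j < m \<Longrightarrow> (\<Sum>i\<le>m. coeff P i * y (i + j)) = 0"
    and "\<And>j. j < m \<Longrightarrow> (\<Sum>i\<le>m. coeff Q i * y (i + j)) = 0"
  shows "y 0 = 0"
proof -
  obtain U V r where r: "r \<noteq> 0" "U * P + V * Q = [:r:]" and U: "degree U < degree Q"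
    using bezout_of_not_dvd_irreducible[OF assms(1,2,5)] .
  \<comment> \<open>The degree of \<open>V\<close> is bounded through \<open>VQ = r - UP\<close> and \<open>deg U < deg Q\<close>.\<close>
  have V: "degree V < m"
  proof (cases "V = 0")
    case False
    have "V * Q = [:r:] - U * P" using r(2) by (simp add: algebra_simps)
    then have "degree V + degree Q = degree ([:r:] - U * P)"
      using False assms(2) by (metis degree_0 degree_mult_eq less_irrefl)
    also have "\<dots> \<le> degree U + degree P"
      using degree_diff_le_max[of "[:r:]" "U * P"] degree_mult_le[of U P] by simp
    finally show ?thesis
      using U assms(4) by linarith
  qed (use assms in auto)
  have "r * y 0 = (\<Sum>k<2 * m. coeff [:r:] k * y k)"
  proof -
    have "(\<Sum>k<2 * m. coeff [:r:] k * y k) = (\<Sum>k\<in>{0}. coeff [:r:] k * y k)"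
      using assms(2,3) by (intro sum.mono_neutral_right) (auto simp: coeff_pCons split: nat.splits)
    then show ?thesis by simp
  qed
  also have "\<dots> = (\<Sum>k<2 * m. coeff (U * P) k * y k) + (\<Sum>k<2 * m. coeff (V * Q) k * y k)"
    by (simp only: r(2)[symmetric] coeff_add distrib_right sum.distrib)
  also have "\<dots> = 0"
    using functional_mult_eq_0[of P m U y] functional_mult_eq_0[of Q m V y] assms U V by simp
  finally show ?thesis using r(1) by simp
qed

text \<open>
  The sum is an integer, and it equals \<open>y\<^sub>0 \<zeta>\<^sup>j R(\<zeta>) - \<Sum> r\<^sub>i (\<zeta>\<^sup>i\<^sup>+\<^sup>j y\<^sub>0 - y\<^sub>i\<^sub>+\<^sub>j)\<close>, which the last
  two hypotheses make smaller than 1 in absolute value.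
\<close>
lemma integer_relation_vanishes:
  fixes R :: "int poly" and y :: "nat \<Rightarrow> int" and \<zeta> \<epsilon> :: real
  assumes "degree R \<le> m" "j < m" "\<And>i. i < 2 * m \<Longrightarrow> \<bar>\<zeta> ^ i * y 0 - y i\<bar> \<le> \<epsilon>"
    and "\<bar>real_of_int (y 0)\<bar> * max 1 \<bar>\<zeta>\<bar> ^ m * \<bar>real_eval R \<zeta>\<bar> + (real m + 1) * real_of_int (poly_height R) * \<epsilon> < 1"
  shows "(\<Sum>i\<le>m. coeff R i * y (i + j)) = 0"
proof -
  let ?s = "\<Sum>i\<le>m. coeff R i * y (i + j)"
  have h: "0 \<le> poly_height R" using abs_coeff_le_height[of R 0] by linarith
  have "real_of_int ?s = y 0 * \<zeta> ^ j * real_eval R \<zeta>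
      - (\<Sum>i\<le>m. coeff R i * (\<zeta> ^ (i + j) * y 0 - y (i + j)))"
    by (simp add: real_eval_altdef[OF assms(1)] sum_distrib_left sum_subtractf algebra_simps power_add
        flip: sum.distrib)
  also have "\<bar>\<dots>\<bar> \<le> \<bar>y 0 * \<zeta> ^ j * real_eval R \<zeta>\<bar>
      + (\<Sum>i\<le>m. \<bar>coeff R i * (\<zeta> ^ (i + j) * y 0 - y (i + j))\<bar>)"
    by (rule order_trans[OF abs_triangle_ineq4 add_left_mono[OF sum_abs]])
  also have "\<dots> \<le> \<bar>real_of_int (y 0)\<bar> * max 1 \<bar>\<zeta>\<bar> ^ m * \<bar>real_eval R \<zeta>\<bar>
      + (\<Sum>i\<le>m. real_of_int (poly_height R) * \<epsilon>)"
  proof (intro add_mono sum_mono)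
    have "\<bar>\<zeta>\<bar> ^ j \<le> max 1 \<bar>\<zeta>\<bar> ^ j"
      by (intro power_mono) auto
    also have "\<dots> \<le> max 1 \<bar>\<zeta>\<bar> ^ m"
      using assms(2) by (intro power_increasing) auto
    finally show "\<bar>y 0 * \<zeta> ^ j * real_eval R \<zeta>\<bar> \<le> \<bar>real_of_int (y 0)\<bar> * max 1 \<bar>\<zeta>\<bar> ^ m * \<bar>real_eval R \<zeta>\<bar>"
      by (auto simp: abs_mult power_abs intro!: mult_right_mono mult_left_mono)
    fix i assume "i \<in> {..m}"
    then have "\<bar>\<zeta> ^ (i + j) * y 0 - y (i + j)\<bar> \<le> \<epsilon>"
      using assms(2) by (intro assms(3)) auto
    moreover have "\<bar>real_of_int (coeff R i)\<bar> \<le> poly_height R"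
      using abs_coeff_le_height[of R i] by linarith
    ultimately show "\<bar>coeff R i * (\<zeta> ^ (i + j) * y 0 - y (i + j))\<bar> \<le> real_of_int (poly_height R) * \<epsilon>"
      using h unfolding abs_mult by (intro mult_mono) auto
  qed
  also have "\<dots> < 1"
    using assms(4) by (simp add: algebra_simps)
  finally have "\<bar>?s\<bar> < 1" by linarith
  then show ?thesis by simp
qed

section \<open>Comparison of the uniform exponents\<close>

definition simult_solvable :: "nat \<Rightarrow> real \<Rightarrow> real \<Rightarrow> real \<Rightarrow> bool" where
  "simult_solvable k \<zeta> \<eta> X \<longleftrightarrow> (\<exists>(x::int) (y::nat \<Rightarrow> int). (x \<noteq> 0 \<or> (\<exists>i\<in>{1..k}. y i \<noteq> 0)) \<and>
     \<bar>real_of_int x\<bar> \<le> X \<and>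
     (MAX i\<in>{1..k}. \<bar>\<zeta> ^ i * real_of_int x - real_of_int (y i)\<bar>) \<le> X powr (- \<eta>))"

lemma lambda_hat_altdef:
  "lambda_hat k \<zeta> = (SUP \<eta>\<in>{\<eta>. \<forall>\<^sub>F X in at_top. simult_solvable k \<zeta> \<eta> X}. ereal \<eta>)"
  unfolding lambda_hat_def simult_solvable_def ..

lemma w_hat_altdef: "w_hat k \<zeta> = (SUP \<omega>\<in>{\<omega>. \<forall>\<^sub>F X in at_top. poly_solvable k \<zeta> \<omega> X}. ereal \<omega>)"
  unfolding w_hat_def poly_solvable_def ..

text \<open>The bound \<open>\<omega> \<le> 1/\<eta>\<close> on exponents can be inverted for the supremum only if that is nonnegative.\<close>
lemma w_hat_nonneg: "0 \<le> w_hat k \<zeta>"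
proof -
  have "\<forall>\<^sub>F X in at_top. poly_solvable k \<zeta> 0 X"
    unfolding poly_solvable_def
    using eventually_ge_at_top[of 1]
    by eventually_elim (auto intro!: exI[of _ 1] simp: poly_height_def)
  then have "ereal 0 \<le> w_hat k \<zeta>"
    unfolding w_hat_altdef by (intro SUP_upper) auto
  then show ?thesis by (simp add: zero_ereal_def)
qed

lemma filterlim_powr_at_top:
  fixes a :: real
  assumes "0 < a"
  shows "filterlim (\<lambda>x. x powr a) at_top at_top"
proof -
  have "filterlim (\<lambda>x::real. exp (a * ln x)) at_top at_top"
    using assms
    by (intro filterlim_compose[OF exp_at_top] filterlim_tendsto_pos_mult_at_top[OF tendsto_const _ ln_at_top])
  moreover have "\<forall>\<^sub>F x::real in at_top. exp (a * ln x) = x powr a"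
    using eventually_gt_at_top[of 0] by eventually_elim (simp add: powr_def)
  ultimately show ?thesis
    by (simp add: filterlim_cong)
qed

lemma uniform_exponents_mult_le_1:
  fixes \<eta> \<omega> \<zeta> :: real
  assumes "\<not> algebraic \<zeta>" "1 \<le> m" "2 * m - 1 \<le> n" "0 < \<eta>" "0 < \<omega>"
    and simult: "\<forall>\<^sub>F X in at_top. simult_solvable n \<zeta> \<eta> X"
    and poly: "\<forall>\<^sub>F X in at_top. poly_solvable m \<zeta> \<omega> X"
  shows "\<eta> * \<omega> \<le> 1"
proof (rule ccontr)
  assume "\<not> ?thesis"
  then have "1 / \<eta> < \<omega>" using assms(4) by (simp add: field_simps)
  then obtain v where v: "1 / \<eta> < v" "v < \<omega>" using dense by blast
  have v0: "0 < v" using v(1) assms(4) by (smt (verit) divide_pos_pos)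
  obtain C :: int where C: "C \<ge> 1" "\<And>A B. A * B \<noteq> 0 \<Longrightarrow> degree (A * B) \<le> m \<Longrightarrow>
       poly_height A * poly_height B \<le> C * poly_height (A * B)"
    by (rule height_mult_le[of m]) blast
  define Z where "Z = max 1 \<bar>\<zeta>\<bar> ^ m"
  have Z: "0 < Z" by (auto simp: Z_def)
  \<comment> \<open>With \<open>X(H) = (KH)\<^sup>1\<^sup>/\<^sup>\<eta>\<close> the approximation error is \<open>X\<^sup>-\<^sup>\<eta> = 1/(KH)\<close>, and \<open>K\<close> is chosen so that
    \<open>m + 1\<close> such errors times a coefficient of size \<open>H\<close> amount to at most \<open>1/2\<close>.\<close>
  define K where "K = 2 * (real m + 1)"
  \<comment> \<open>Nonzero multiples of \<open>Q\<close> of degree at most \<open>m\<close> have height at least \<open>H/C\<close>,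
    twice the bound \<open>DH\<close> imposed on \<open>P\<close>.\<close>
  define D where "D = 1 / (2 * real_of_int C)"
  have D: "0 < D" "D \<le> 1" using C(1) by (auto simp: D_def divide_simps)
  define X where "X H = (K * H) powr (1 / \<eta>)" for H
  have K: "0 < K" by (simp add: K_def)
  have KH: "filterlim (\<lambda>H. K * H) at_top at_top"
    using K by (intro filterlim_tendsto_pos_mult_at_top[OF tendsto_const] filterlim_ident)
  have X_lim: "filterlim X at_top at_top"
    unfolding X_def using assms(4) by (intro filterlim_compose[OF filterlim_powr_at_top KH]) auto
  have D_lim: "filterlim (\<lambda>H. D * H) at_top at_top"
    using D by (intro filterlim_tendsto_pos_mult_at_top[OF tendsto_const] filterlim_ident)
  \<comment> \<open>The main term \<open>\<bar>y\<^sub>0\<bar> Z \<bar>R(\<zeta>)\<bar>\<close> has order \<open>H\<^sup>1\<^sup>/\<^sup>\<eta>\<^sup>-\<^sup>u\<close>; it is needed for \<open>u = v\<close>, \<open>E = 1\<close>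
    and for \<open>u = \<omega>\<close>, \<open>E = D\<close>.\<close>
  have small: "\<forall>\<^sub>F H in at_top. X H * Z * (E * H) powr (-u) < 1 / 2" if "1 / \<eta> < u" "0 < E" for E u
  proof -
    have "((\<lambda>H::real. K powr (1 / \<eta>) * Z * E powr (-u) * H powr (1 / \<eta> - u)) \<longlongrightarrow> K powr (1 / \<eta>) * Z * E powr (-u) * 0) at_top"
      using that by (intro tendsto_intros tendsto_neg_powr filterlim_ident) auto
    then have "\<forall>\<^sub>F H::real in at_top. K powr (1 / \<eta>) * Z * E powr (-u) * H powr (1 / \<eta> - u) < 1 / 2"
      by (rule order_tendstoD) simp
    then show ?thesis
      using eventually_gt_at_top[of 0]
    proof eventually_elim
      case (elim H)
      have "X H * Z * (E * H) powr (-u) = K powr (1 / \<eta>) * Z * E powr (-u) * (H powr (1 / \<eta>) * H powr (-u))"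
        using K elim(2) that(2) by (simp add: X_def powr_mult)
      also have "H powr (1 / \<eta>) * H powr (-u) = H powr (1 / \<eta> - u)"
        by (simp flip: powr_add)
      finally show ?case using elim(1) by (simp only:)
    qed
  qed
  have "\<forall>\<^sub>F H in at_top. simult_solvable n \<zeta> \<eta> (X H) \<and> poly_solvable m \<zeta> \<omega> (D * H) \<and>
      X H * Z * (1 * H) powr (-v) < 1 / 2 \<and> X H * Z * (D * H) powr (-\<omega>) < 1 / 2 \<and> 1 < H"
    by (intro eventually_conj eventually_compose_filterlim[OF simult X_lim]
        eventually_compose_filterlim[OF poly D_lim] small eventually_gt_at_top)
      (use v \<open>1 / \<eta> < \<omega>\<close> D in auto)
  then obtain B where B: "\<And>H. B \<le> H \<Longrightarrow> simult_solvable n \<zeta> \<eta> (X H) \<and> poly_solvable m \<zeta> \<omega> (D * H) \<and>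
      X H * Z * (1 * H) powr (-v) < 1 / 2 \<and> X H * Z * (D * H) powr (-\<omega>) < 1 / 2 \<and> 1 < H"
    unfolding eventually_at_top_linorder by blast
  obtain Q where Q: "irreducible Q" "0 < degree Q" "degree Q \<le> m" "poly_height Q > \<lceil>B\<rceil>"
    "\<bar>real_eval Q \<zeta>\<bar> < real_of_int (poly_height Q) powr (-v)"
    using irreducible_approximations[OF assms(1) v0 v(2) poly] by blast
  define H where "H = real_of_int (poly_height Q)"
  have "B \<le> H" unfolding H_def using Q(4) by linarith
  then have ex_xy: "simult_solvable n \<zeta> \<eta> (X H)" and ex_P: "poly_solvable m \<zeta> \<omega> (D * H)"
    and XQ: "X H * Z * H powr (-v) < 1 / 2" and XP: "X H * Z * (D * H) powr (-\<omega>) < 1 / 2"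
    and H: "1 < H"
    using B[of H] by auto
  have Q_small: "\<bar>real_eval Q \<zeta>\<bar> \<le> H powr (-v)"
    using Q(5) by (simp add: H_def)
  obtain P where P: "degree P \<le> m" "poly_height P \<le> D * H" "0 < \<bar>real_eval P \<zeta>\<bar>"
    "\<bar>real_eval P \<zeta>\<bar> \<le> (D * H) powr (- \<omega>)"
    using ex_P unfolding poly_solvable_def by blast
  obtain x y where xy: "x \<noteq> 0 \<or> (\<exists>i\<in>{1..n}. y i \<noteq> 0)" "\<bar>real_of_int x\<bar> \<le> X H"
    "(MAX i\<in>{1..n}. \<bar>\<zeta> ^ i * real_of_int x - real_of_int (y i)\<bar>) \<le> X H powr (- \<eta>)"
    using ex_xy unfolding simult_solvable_def by blast
  define \<epsilon> where "\<epsilon> = 1 / (K * H)"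
  have "X H powr (- \<eta>) = \<epsilon>"
    using K H assms(4) by (simp add: X_def powr_powr powr_minus \<epsilon>_def field_simps)
  moreover have "\<bar>\<zeta> ^ i * real_of_int x - real_of_int (y i)\<bar> \<le> (MAX i\<in>{1..n}. \<bar>\<zeta> ^ i * real_of_int x - real_of_int (y i)\<bar>)"
    if "i \<in> {1..n}" for i
    using that by (intro Max_ge) auto
  ultimately have close: "\<bar>\<zeta> ^ i * real_of_int x - real_of_int (y i)\<bar> \<le> \<epsilon>" if "i \<in> {1..n}" for i
    using xy(3) that by fastforce
  have \<epsilon>: "0 < \<epsilon>" "\<epsilon> < 1" "(real m + 1) * (H * \<epsilon>) = 1 / 2"
  proof -
    have "1 < K * H"
      using H by (intro less_1_mult) (auto simp: K_def)
    then show "0 < \<epsilon>" "\<epsilon> < 1" by (auto simp: \<epsilon>_def)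
    show "(real m + 1) * (H * \<epsilon>) = 1 / 2"
      using H K by (simp add: \<epsilon>_def) (simp add: K_def field_simps)
  qed
  define y' where "y' = y(0 := x)"
  have vanish: "(\<Sum>i\<le>m. coeff R i * y' (i + j)) = 0"
    if R: "degree R \<le> m" "poly_height R \<le> H" "X H * Z * e < 1 / 2" "\<bar>real_eval R \<zeta>\<bar> \<le> e"
      and j: "j < m" for R e j
  proof (rule integer_relation_vanishes[OF R(1) j, of \<zeta> _ \<epsilon>])
    show "\<bar>\<zeta> ^ i * y' 0 - y' i\<bar> \<le> \<epsilon>" if "i < 2 * m" for i
      using close[of i] \<epsilon>(1) that assms(3) by (cases "i = 0") (auto simp: y'_def)
    have "\<bar>real_of_int (y' 0)\<bar> * Z * \<bar>real_eval R \<zeta>\<bar> \<le> X H * Z * e"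
      using xy(2) R(4) Z by (intro mult_mono) (auto simp: y'_def X_def)
    moreover have "(real m + 1) * real_of_int (poly_height R) * \<epsilon> \<le> (real m + 1) * (H * \<epsilon>)"
      using mult_right_mono[OF R(2), of "(real m + 1) * \<epsilon>"] \<epsilon>(1) by (simp add: algebra_simps)
    ultimately show "\<bar>real_of_int (y' 0)\<bar> * max 1 \<bar>\<zeta>\<bar> ^ m * \<bar>real_eval R \<zeta>\<bar>
        + (real m + 1) * real_of_int (poly_height R) * \<epsilon> < 1"
      using R(3) \<epsilon>(3) unfolding Z_def by linarith
  qed
  have not_dvd: "\<not> Q dvd P"
  proof
    assume "Q dvd P"
    then obtain A where A: "P = Q * A" by auto
    have P0: "P \<noteq> 0" using P(3) by auto
    have "poly_height Q * 1 \<le> poly_height Q * poly_height A"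
      using A P0 height_pos[of A] height_pos[of Q] by (intro mult_left_mono) auto
    also have "\<dots> \<le> C * poly_height P"
      using C(2)[of Q A] A P0 P(1) by simp
    finally have "H \<le> C * real_of_int (poly_height P)"
      unfolding H_def by (metis mult.right_neutral of_int_le_iff of_int_mult)
    also have "\<dots> \<le> C * (D * H)"
      using P(2) C(1) by (intro mult_left_mono) auto
    also have "\<dots> = H / 2"
      using C(1) by (simp add: D_def)
    finally show False using H by simp
  qed
  have "D * H \<le> 1 * H" using D H by (intro mult_right_mono) auto
  then have HP: "poly_height P \<le> H" using P(2) by linarith
  have "y' 0 = 0"
    using Q P(1) not_dvd vanish[OF P(1) HP XP P(4)] vanish[OF Q(3) _ XQ Q_small]
    by (intro common_recurrences_imp_first_0[of Q m P y']) (auto simp: H_def)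
  then have x: "x = 0" by (simp add: y'_def)
  with xy(1) obtain i where i: "i \<in> {1..n}" "y i \<noteq> 0" by auto
  have "\<bar>real_of_int (y i)\<bar> < 1"
    using close[OF i(1)] x \<epsilon>(2) by simp
  with i(2) show False by simp
qed

theorem corollary2p2:
  fixes n :: nat and \<zeta> :: real
  assumes "n \<ge> 1" and "\<not> algebraic \<zeta>"
  shows "lambda_hat n \<zeta> \<le> 1 / w_hat (nat \<lceil>real n / 2\<rceil>) \<zeta>"
proof -
  define m where "m = nat \<lceil>real n / 2\<rceil>"
  have m: "1 \<le> m" "2 * m - 1 \<le> n"
    unfolding m_def using assms(1) by linarith+
  have "ereal \<eta> \<le> 1 / w_hat m \<zeta>"
    if \<eta>: "\<forall>\<^sub>F X in at_top. simult_solvable n \<zeta> \<eta> X" for \<eta>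
  proof (cases "0 < \<eta>")
    case True
    have "w_hat m \<zeta> \<le> ereal (1 / \<eta>)"
      unfolding w_hat_altdef
    proof (intro SUP_least, clarify)
      fix \<omega> :: real
      assume \<omega>: "\<forall>\<^sub>F X in at_top. poly_solvable m \<zeta> \<omega> X"
      have "\<omega> \<le> 1 / \<eta>"
      proof (cases "0 < \<omega>")
        case True
        then show ?thesis
          using uniform_exponents_mult_le_1[OF assms(2) m \<open>0 < \<eta>\<close> _ \<eta> \<omega>] \<open>0 < \<eta>\<close>
          by (simp add: field_simps)
      next
        case False
        moreover have "0 \<le> 1 / \<eta>" using \<open>0 < \<eta>\<close> by simp
        ultimately show ?thesis by linarith
      qed
      then show "ereal \<omega> \<le> ereal (1 / \<eta>)" by simp
    qed
    with w_hat_nonneg[of m \<zeta>] True show ?thesis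
      by (cases "w_hat m \<zeta>") (auto simp: divide_ereal_def one_ereal_def field_simps)
  next
    case False
    have "ereal \<eta> \<le> 0" using False by (simp add: zero_ereal_def)
    also have "0 \<le> 1 / w_hat m \<zeta>"
      using w_hat_nonneg[of m \<zeta>] by (cases "w_hat m \<zeta>") (auto simp: divide_ereal_def one_ereal_def)
    finally show ?thesis .
  qed
  then show ?thesis
    unfolding lambda_hat_altdef m_def[symmetric] by (intro SUP_least) auto
qed

end
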